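(* Let $X\in\mathcal{S}$ be a stable matching different from $X^{\max}$, and let $Y\in \mathcal{S}$ satisfy $X\prec_F Y$. Then there exists $X'\in\mathcal{S}_X$ such that $X'\preceq_F Y$, where $\mathcal{S}_X:=\{(X\setminus L^-)\cup L^+ : L\in\mathcal{L}(X)\}$ is the set of matchings obtained from $X$ by applying the rotations $L\in\mathcal{L}(X)$.
   Context: Setting. $G=(V,E)$ is a finite bipartite graph without multiple edges, with vertex parts $W$ and $F$; the edge joining $w\in W$ and $f\in F$ is denoted $wf$. $E_v$ is the set of edges incident to $v\in V$, and $X_v:=X\cap E_v$ for $X\subseteq E$. Each $w\in W$ has a strict linear order $>_w$ on $E_w$ ($e>_w e'$ means that $e$ is preferred to $e'$) and quota $q(w)=1$; accordingly $C_w(Z)$, for nonempty $Z\subseteq E_w$, is the one-element set formed by the $>_w$-largest element of $Z$, and $C_w(\emptyset)=\emptyset$. Each $f\in F$ has a choice function $C_f:2^{E_f}\to 2^{E_f}$ with $C_f(Z)\subseteq Z$, satisfying for all $Z,Z'\subseteq E_f$: (A1) if $Z\supseteq Z'\supseteq C_f(Z)$ then $C_f(Z')=C_f(Z)$; (A2) if $Z\supseteq Z'$ then $C_f(Z)\cap Z'\subseteq C_f(Z')$; (A3) if $Z\supseteq Z'$ then $|C_f(Z)|\ge |C_f(Z')|$. Stability. A matching is an arbitrary subset $X\subseteq E$. A set $Z\subseteq E_v$ is acceptable if $C_v(Z)=Z$; $X\subseteq E$ is acceptable if all $X_v$, $v\in V$, are. For acceptable $Z,Z'\subseteq E_v$,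 $Z\succeq_v Z'$ means $C_v(Z\cup Z')=Z$. For distinct acceptable matchings $X,Y$, $X\succ_F Y$ (also written $Y\prec_F X$) means $X_f\succeq_f Y_f$ for all $f\in F$; $\preceq_F$ means $\prec_F$ or equal. An acceptable $X$ is stable if there is no edge $e=wf\in E\setminus X$ with both $e\in C_w(X_w\cup\{e\})$ and $e\in C_f(X_f\cup\{e\})$. $\mathcal{S}$ is the set of stable matchings. It is known that $\mathcal{S}\neq\emptyset$ and $(\mathcal{S},\prec_F)$ is a distributive lattice; its minimal and maximal elements are denoted $X^{\min}$, $X^{\max}$. Active graph and rotations. Let $X\in\mathcal{S}$. For $w\in W$ with $|X_w|=1$, let $x_w$ be the unique edge of $X_w$. If the set of edges $e=wf\in E_w$ with $x_w>_w e$ and $e\in C_f(X_f\cup\{e\})$ is nonempty, its $>_w$-largest element is called $W$-admissible and denoted $a_w$. If $a_w=wf$ and $C_f(X_f\cup\{a_w\})=(X_f\setminus\{e'\})\cup\{a_w\}$ for some $e'\in X_f$, then $e'$ is called $F$-admissible, is denoted $b^w_f$ and said to be associated with $a_w$, and $(a_w,b^w_f)$ is called a tandem passing $f$ (the only other possibility is $C_f(X_f\cup\{a_w\})=X_f\cup\{a_w\}$, when $a_w$ generates no tandem). Let $D(X)$ be the directed graph on $V$ whose edges are the $W$-admissible edges directed from $W$ to $F$ and the $F$-admissible edges directed from $F$ to $W$. Cleaning procedure: as long as the current graph has a vertex $w\in W$ with a leaving edge $a_w=(w,f)$ but no entering edge, delete $a_w$, and if $a_w$ has an associated edge $b^w_f$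 which occurs in no other tandem passing $f$ in the current graph, delete $b^w_f$ as well; isolated vertices are removed. The final graph $\Gamma(X)$ is the active graph of $X$. In it every $w\in W$ that remains has exactly one entering and one leaving edge, and for every remaining $f\in F$ the tandems passing $f$ partition the set of edges at $f$. Hence $\Gamma(X)$ decomposes uniquely into pairwise edge-disjoint directed cycles (edge-simple, possibly visiting a vertex of $F$ several times) which at each $w\in W$ go from the entering to the leaving edge, and at each visit to $f\in F$ traverse a tandem ($a_w$, then $b^w_f$). These cycles are the rotations generated by $X$; their set is $\mathcal{L}(X)$. For a rotation $L$, $L^+$ is the set of its edges going from $W$ to $F$ and $L^-$ the set of its edges going from $F$ to $W$ (both regarded as subsets of $E$). *)

theory Defs
  imports Main
begin

text \<open>
  Both vertex parts live in one vertex type. An undirected edge joining \<open>w\<close> in \<open>W\<close> and \<open>f\<close> in \<open>F\<close>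
  is the pair \<open>(w, f)\<close>, in this order, so there are no multiple edges.
  \<open>(e, e') \<in> pref M w\<close> means \<open>e >\<^sub>w e'\<close>.
\<close>

record 'v market =
  Wpart :: "'v set"
  Fpart :: "'v set"
  edges :: "('v \<times> 'v) set"
  pref :: "'v \<Rightarrow> ('v \<times> 'v) rel"
  chF :: "'v \<Rightarrow> ('v \<times> 'v) set \<Rightarrow> ('v \<times> 'v) set"

text \<open>\<open>X\<^sub>v\<close>; in particular \<open>E\<^sub>v\<close> is \<open>at_vertex (edges M) v\<close>.\<close>

definition at_vertex :: "('v \<times> 'v) set \<Rightarrow> 'v \<Rightarrow> ('v \<times> 'v) set" where
  "at_vertex X v = {e \<in> X. fst e = v \<or> snd e = v}"

locale choice_market =
  fixes M :: "'v market"
  assumes finite_W: "finite (Wpart M)"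
    and finite_F: "finite (Fpart M)"
    and disjoint_parts: "Wpart M \<inter> Fpart M = {}"
    and edges_subset: "edges M \<subseteq> Wpart M \<times> Fpart M"
    and pref_field: "w \<in> Wpart M \<Longrightarrow>
          pref M w \<subseteq> at_vertex (edges M) w \<times> at_vertex (edges M) w"
    and pref_linear: "w \<in> Wpart M \<Longrightarrow>
          strict_linear_order_on (at_vertex (edges M) w) (pref M w)"
    and ch_subset: "\<lbrakk>f \<in> Fpart M; Z \<subseteq> at_vertex (edges M) f\<rbrakk> \<Longrightarrow> chF M f Z \<subseteq> Z"
    and A1: "\<lbrakk>f \<in> Fpart M; Z \<subseteq> at_vertex (edges M) f; Z' \<subseteq> Z; chF M f Z \<subseteq> Z'\<rbrakk>
          \<Longrightarrow> chF M f Z' = chF M f Z"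
    and A2: "\<lbrakk>f \<in> Fpart M; Z \<subseteq> at_vertex (edges M) f; Z' \<subseteq> Z\<rbrakk>
          \<Longrightarrow> chF M f Z \<inter> Z' \<subseteq> chF M f Z'"
    and A3: "\<lbrakk>f \<in> Fpart M; Z \<subseteq> at_vertex (edges M) f; Z' \<subseteq> Z\<rbrakk>
          \<Longrightarrow> card (chF M f Z') \<le> card (chF M f Z)"

text \<open>The largest element of \<open>Z\<close> under \<open>r\<close>, as a set of at most one element.\<close>

definition best :: "'e rel \<Rightarrow> 'e set \<Rightarrow> 'e set" where
  "best r Z = {e \<in> Z. \<forall>e' \<in> Z - {e}. (e, e') \<in> r}"

definition choice :: "'v market \<Rightarrow> 'v \<Rightarrow> ('v \<times> 'v) set \<Rightarrow> ('v \<times> 'v) set" where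
  "choice M v Z = (if v \<in> Wpart M then best (pref M v) Z else chF M v Z)"


subsection \<open>Stable matchings and the order on them\<close>

definition acceptable :: "'v market \<Rightarrow> ('v \<times> 'v) set \<Rightarrow> bool" where
  "acceptable M X \<longleftrightarrow> X \<subseteq> edges M \<and>
     (\<forall>v \<in> Wpart M \<union> Fpart M. choice M v (at_vertex X v) = at_vertex X v)"

definition stable :: "'v market \<Rightarrow> ('v \<times> 'v) set \<Rightarrow> bool" where
  "stable M X \<longleftrightarrow> acceptable M X \<and>
     \<not> (\<exists>w f. (w, f) \<in> edges M - X \<and>
           (w, f) \<in> choice M w (at_vertex X w \<union> {(w, f)}) \<and>
           (w, f) \<in> choice M f (at_vertex X f \<union> {(w, f)}))"

text \<open>\<open>Z \<succeq>\<^sub>v Z'\<close>, meaningful for acceptable \<open>Z\<close> and \<open>Z'\<close>.\<close>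

definition succeq_at :: "'v market \<Rightarrow> 'v \<Rightarrow> ('v \<times> 'v) set \<Rightarrow> ('v \<times> 'v) set \<Rightarrow> bool" where
  "succeq_at M v Z Z' \<longleftrightarrow> choice M v (Z \<union> Z') = Z"

definition prec_F :: "'v market \<Rightarrow> ('v \<times> 'v) set \<Rightarrow> ('v \<times> 'v) set \<Rightarrow> bool" where
  "prec_F M X Y \<longleftrightarrow> acceptable M X \<and> acceptable M Y \<and> X \<noteq> Y \<and>
     (\<forall>f \<in> Fpart M. succeq_at M f (at_vertex Y f) (at_vertex X f))"

definition preceq_F :: "'v market \<Rightarrow> ('v \<times> 'v) set \<Rightarrow> ('v \<times> 'v) set \<Rightarrow> bool" where
  "preceq_F M X Y \<longleftrightarrow> prec_F M X Y \<or> X = Y"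

definition X_max :: "'v market \<Rightarrow> ('v \<times> 'v) set" where
  "X_max M = (THE X. stable M X \<and> (\<forall>Y. stable M Y \<longrightarrow> preceq_F M Y X))"


subsection \<open>Admissible edges and the active graph\<close>

definition W_candidates :: "'v market \<Rightarrow> ('v \<times> 'v) set \<Rightarrow> 'v \<Rightarrow> ('v \<times> 'v) set" where
  "W_candidates M X w = {e \<in> at_vertex (edges M) w.
     \<exists>x. at_vertex X w = {x} \<and> (x, e) \<in> pref M w \<and>
         e \<in> choice M (snd e) (at_vertex X (snd e) \<union> {e})}"

text \<open>\<open>W_admissible M X w a\<close>: the edge \<open>a\<^sub>w\<close> exists and equals \<open>a\<close>.\<close>

definition W_admissible :: "'v market \<Rightarrow> ('v \<times> 'v) set \<Rightarrow> 'v \<Rightarrow> ('v \<times> 'v) \<Rightarrow> bool" where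
  "W_admissible M X w a \<longleftrightarrow> w \<in> Wpart M \<and> a \<in> best (pref M w) (W_candidates M X w)"

text \<open>\<open>tandem M X a b\<close>: \<open>(a, b)\<close> is a tandem; it passes the vertex \<open>snd a = snd b\<close>.\<close>

definition tandem :: "'v market \<Rightarrow> ('v \<times> 'v) set \<Rightarrow> ('v \<times> 'v) \<Rightarrow> ('v \<times> 'v) \<Rightarrow> bool" where
  "tandem M X a b \<longleftrightarrow> (\<exists>w. W_admissible M X w a) \<and> b \<in> at_vertex X (snd a) \<and>
     choice M (snd a) (at_vertex X (snd a) \<union> {a}) = (at_vertex X (snd a) - {b}) \<union> {a}"

text \<open>
  A directed graph is given by its set of arcs, so isolated vertices disappear automatically.
  An edge \<open>(w, f)\<close> directed from \<open>W\<close> to \<open>F\<close> is the arc \<open>(w, f)\<close> itself; directed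
  from \<open>F\<close> to \<open>W\<close> it is the arc \<open>prod.swap (w, f)\<close>.
\<close>

definition D_graph :: "'v market \<Rightarrow> ('v \<times> 'v) set \<Rightarrow> ('v \<times> 'v) set" where
  "D_graph M X = {a. \<exists>w. W_admissible M X w a} \<union> {prod.swap b | a b. tandem M X a b}"

definition tandem_in :: "'v market \<Rightarrow> ('v \<times> 'v) set \<Rightarrow> ('v \<times> 'v) set \<Rightarrow>
    ('v \<times> 'v) \<Rightarrow> ('v \<times> 'v) \<Rightarrow> bool" where
  "tandem_in M X G a b \<longleftrightarrow> tandem M X a b \<and> a \<in> G \<and> prod.swap b \<in> G"

definition clean_step :: "'v market \<Rightarrow> ('v \<times> 'v) set \<Rightarrow> ('v \<times> 'v) set \<Rightarrow> ('v \<times> 'v) set \<Rightarrow> bool" where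
  "clean_step M X G G' \<longleftrightarrow>
     (\<exists>w a. W_admissible M X w a \<and> a \<in> G \<and> (\<nexists>u. (u, w) \<in> G) \<and>
        G' = G - {a} -
          {prod.swap b | b. tandem M X a b \<and> \<not> (\<exists>a'. a' \<noteq> a \<and> tandem_in M X G a' b)})"

definition final_graph :: "'v market \<Rightarrow> ('v \<times> 'v) set \<Rightarrow> ('v \<times> 'v) set \<Rightarrow> bool" where
  "final_graph M X G \<longleftrightarrow>
     (clean_step M X)\<^sup>*\<^sup>* (D_graph M X) G \<and> \<not> (\<exists>G'. clean_step M X G G')"

text \<open>The order of deletions is irrelevant; see \<open>ex1_final_graph\<close> below.\<close>

definition active_graph :: "'v market \<Rightarrow> ('v \<times> 'v) set \<Rightarrow> ('v \<times> 'v) set" where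
  "active_graph M X = (THE G. final_graph M X G)"


subsection \<open>Rotations\<close>

text \<open>
  \<open>d'\<close> may follow \<open>d\<close> on a cycle of the active graph: at a vertex of \<open>F\<close> the two arcs form a
  tandem, and at a vertex of \<open>W\<close> the cycle passes from the entering to the leaving arc.
\<close>

definition follows :: "'v market \<Rightarrow> ('v \<times> 'v) set \<Rightarrow> ('v \<times> 'v) \<Rightarrow> ('v \<times> 'v) \<Rightarrow> bool" where
  "follows M X d d' \<longleftrightarrow>
     (\<exists>b. tandem M X d b \<and> d' = prod.swap b) \<or> (snd d \<in> Wpart M \<and> fst d' = snd d)"

definition rotation_cycle :: "'v market \<Rightarrow> ('v \<times> 'v) set \<Rightarrow> ('v \<times> 'v) list \<Rightarrow> bool" where
  "rotation_cycle M X ds \<longleftrightarrow> ds \<noteq> [] \<and> distinct ds \<and> set ds \<subseteq> active_graph M X \<and>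
     (\<forall>i < length ds. follows M X (ds ! i) (ds ! (Suc i mod length ds)))"

text \<open>A rotation is represented by its set of arcs, i.e. independently of a starting point.\<close>

definition rotations :: "'v market \<Rightarrow> ('v \<times> 'v) set \<Rightarrow> ('v \<times> 'v) set set" where
  "rotations M X = {set ds | ds. rotation_cycle M X ds}"

definition L_plus :: "'v market \<Rightarrow> ('v \<times> 'v) set \<Rightarrow> ('v \<times> 'v) set" where
  "L_plus M L = {e \<in> edges M. e \<in> L}"

definition L_minus :: "'v market \<Rightarrow> ('v \<times> 'v) set \<Rightarrow> ('v \<times> 'v) set" where
  "L_minus M L = {e \<in> edges M. prod.swap e \<in> L}"

definition S_after :: "'v market \<Rightarrow> ('v \<times> 'v) set \<Rightarrow> ('v \<times> 'v) set set" where
  "S_after M X = {(X - L_minus M L) \<union> L_plus M L | L. L \<in> rotations M X}"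


subsection \<open>The cleaning procedure has a unique result\<close>

lemma clean_step_psubset: "clean_step M X G G' \<Longrightarrow> G' \<subset> G"
  unfolding clean_step_def by blast

context choice_market
begin

lemma W_admissibleD:
  assumes "W_admissible M X w a" "X \<subseteq> edges M"
  shows "a \<in> edges M" "fst a = w" "w \<in> Wpart M" "snd a \<in> Fpart M" "a \<notin> X"
proof -
  show w: "w \<in> Wpart M"
    using assms(1) by (simp add: W_admissible_def)
  have c: "a \<in> W_candidates M X w"
    using assms(1) by (simp add: W_admissible_def best_def)
  then show e: "a \<in> edges M"
    by (simp add: W_candidates_def at_vertex_def)
  then show "snd a \<in> Fpart M"
    using edges_subset by auto
  then show f: "fst a = w"
    using c w disjoint_parts by (auto simp: W_candidates_def at_vertex_def)
  obtain x where x: "at_vertex X w = {x}" "(x, a) \<in> pref M w"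
    using c by (auto simp: W_candidates_def)
  have "irrefl (pref M w)"
    using pref_linear[OF w] by (simp add: strict_linear_order_on_def)
  then have "a \<noteq> x"
    using x(2) by (metis irreflD)
  then show "a \<notin> X"
    using x(1) f unfolding at_vertex_def by blast
qed

lemma finite_D_graph:
  assumes "X \<subseteq> edges M"
  shows "finite (D_graph M X)"
proof -
  have "D_graph M X \<subseteq> edges M \<union> prod.swap ` X"
    using W_admissibleD(1)[OF _ assms]
    by (auto simp: D_graph_def tandem_def at_vertex_def)
  moreover have "finite (edges M)"
    using finite_subset[OF edges_subset] finite_W finite_F by blast
  ultimately show ?thesis
    using assms by (meson finite_Un finite_imageI finite_subset)
qed

lemma clean_step_diamond:
  assumes X: "X \<subseteq> edges M" and s1: "clean_step M X G G1" and s2: "clean_step M X G G2"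
  shows "G1 = G2 \<or> (\<exists>G3. clean_step M X G1 G3 \<and> clean_step M X G2 G3)"
proof -
  define B where "B G a = {prod.swap b | b. tandem M X a b \<and>
    \<not> (\<exists>a'. a' \<noteq> a \<and> tandem_in M X G a' b)}" for G a
  obtain w1 a1 where 1: "W_admissible M X w1 a1" "a1 \<in> G" "\<nexists>u. (u, w1) \<in> G" "G1 = G - {a1} - B G a1"
    using s1 unfolding clean_step_def B_def by blast
  obtain w2 a2 where 2: "W_admissible M X w2 a2" "a2 \<in> G" "\<nexists>u. (u, w2) \<in> G" "G2 = G - {a2} - B G a2"
    using s2 unfolding clean_step_def B_def by blast
  have adm_not_swap: "a \<noteq> prod.swap b" if "W_admissible M X w a" "tandem M X c b" for w a b c
  proof -
    have "b \<in> X"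
      using that(2) by (simp add: tandem_def at_vertex_def)
    then have "snd b \<in> Fpart M"
      using X edges_subset by auto
    then show ?thesis
      using W_admissibleD(2,3)[OF that(1) X] disjoint_parts by auto
  qed
  show ?thesis
  proof (cases "a1 = a2")
    case True
    then show ?thesis using 1 2 by simp
  next
    case False
    have notB: "a2 \<notin> B G a1" "a1 \<notin> B G a2"
      using adm_not_swap 1(1) 2(1) unfolding B_def by blast+
    have key: "d \<in> G1 - {a2} - B G1 a2 \<longleftrightarrow> d \<in> G \<and> d \<noteq> a1 \<and> d \<noteq> a2 \<and>
        \<not> (\<exists>b. d = prod.swap b \<and> (tandem M X a1 b \<or> tandem M X a2 b) \<and>
          \<not> (\<exists>a'. a' \<noteq> a1 \<and> a' \<noteq> a2 \<and> tandem_in M X G a' b))"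
      if *: "W_admissible M X w1 a1" "W_admissible M X w2 a2" "a1 \<in> G" "a2 \<in> G"
        "a1 \<noteq> a2" "G1 = G - {a1} - B G a1"
      for a1 a2 w1 w2 G1 d
    proof (cases "\<exists>b a. d = prod.swap b \<and> tandem M X a b")
      case False
      then have "d \<notin> B H c" for H c
        unfolding B_def by blast
      then have "d \<in> G1 - {a2} - B G1 a2 \<longleftrightarrow> d \<in> G \<and> d \<noteq> a1 \<and> d \<noteq> a2"
        using *(6) by simp
      then show ?thesis
        using False by metis
    next
      case True
      then obtain b a where d: "d = prod.swap b" "tandem M X a b" by blast
      have swap: "prod.swap b = prod.swap c \<longleftrightarrow> b = c" for c :: "'v \<times> 'v"
        by (metis swap_swap)
      have inB: "d \<in> B H c \<longleftrightarrow> tandem M X c b \<and> \<not> (\<exists>a'. a' \<noteq> c \<and> tandem_in M X H a' b)" for H c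
        unfolding B_def d(1) mem_Collect_eq swap by metis
      have ne: "d \<noteq> a1" "d \<noteq> a2"
        using adm_not_swap *(1,2) d by blast+
      have notin: "c \<notin> B G a1" if "tandem M X c b'" for c b'
        using adm_not_swap that unfolding B_def tandem_def[of M X c b'] by blast
      have t: "tandem_in M X H c b \<longleftrightarrow> tandem M X c b \<and> c \<in> H \<and> d \<in> H" for H c
        unfolding tandem_in_def d(1) ..
      have tin: "tandem_in M X G1 c b \<longleftrightarrow> tandem M X c b \<and> c \<in> G \<and> c \<noteq> a1 \<and> d \<in> G1" for c
        unfolding t using notin[of c b] *(6) by auto
      have G1: "d \<in> G1 \<longleftrightarrow> d \<in> G \<and> d \<notin> B G a1"
        using ne *(6) by blast
      define O' where "O' \<longleftrightarrow> (\<exists>a'. a' \<noteq> a1 \<and> a' \<noteq> a2 \<and> tandem M X a' b \<and> a' \<in> G)"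
      have ex: "(\<exists>c. d = prod.swap c \<and> (tandem M X a1 c \<or> tandem M X a2 c) \<and>
          \<not> (\<exists>a'. a' \<noteq> a1 \<and> a' \<noteq> a2 \<and> tandem_in M X G a' c)) \<longleftrightarrow>
        (tandem M X a1 b \<or> tandem M X a2 b) \<and> \<not> (O' \<and> d \<in> G)"
        unfolding O'_def d(1) swap tandem_in_def by auto
      have "d \<in> B G a1 \<longleftrightarrow> tandem M X a1 b \<and> \<not> ((tandem M X a2 b \<or> O') \<and> d \<in> G)"
        unfolding inB t O'_def using *(4,5) by metis
      moreover have "d \<in> B G1 a2 \<longleftrightarrow> tandem M X a2 b \<and> \<not> (O' \<and> d \<in> G1)"
        unfolding inB tin O'_def by metis
      ultimately show ?thesis
        unfolding ex using ne G1 by blast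
    qed
    have "G1 - {a2} - B G1 a2 = G2 - {a1} - B G2 a1"
    proof (rule set_eqI)
      fix d
      note k1 = key[OF 1(1) 2(1) 1(2) 2(2) False 1(4), of d]
      note k2 = key[OF 2(1) 1(1) 2(2) 1(2) False[symmetric] 2(4), of d]
      show "d \<in> G1 - {a2} - B G1 a2 \<longleftrightarrow> d \<in> G2 - {a1} - B G2 a1"
        unfolding k1 k2 by (simp only: conj_ac disj_commute)
    qed
    moreover have "clean_step M X G1 (G1 - {a2} - B G1 a2)"
      unfolding clean_step_def B_def[symmetric] using 1 2 False notB by blast
    moreover have "clean_step M X G2 (G2 - {a1} - B G2 a1)"
      unfolding clean_step_def B_def[symmetric] using 1 2 False notB by blast
    ultimately show ?thesis by metis
  qed
qed

lemma ex1_clean_normal_form: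
  assumes X: "X \<subseteq> edges M" and "finite G"
  shows "\<exists>!N. (clean_step M X)\<^sup>*\<^sup>* G N \<and> \<not> (\<exists>G'. clean_step M X N G')"
  using assms(2)
proof (induction G rule: finite_psubset_induct)
  case (psubset G)
  let ?r = "clean_step M X"
  let ?nf = "\<lambda>G N. ?r\<^sup>*\<^sup>* G N \<and> \<not> (\<exists>G'. ?r N G')"
  have IH: "\<exists>!N. ?nf H N" if "?r G H" for H
    using psubset.IH[of H] clean_step_psubset[OF that] by blast
  show ?case
  proof (cases "\<exists>H. ?r G H")
    case False
    then show ?thesis
      by (metis converse_rtranclpE rtranclp.rtrancl_refl)
  next
    case True
    then obtain H N where H: "?r G H" "?nf H N"
      using IH by blast
    have "N' = N" if N': "?nf G N'" for N'
    proof -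
      obtain H' where H': "?r G H'" "?nf H' N'"
        using N' True by (metis converse_rtranclpE)
      consider "H = H'" | K where "?r H K" "?r H' K"
        using clean_step_diamond[OF X H(1) H'(1)] by blast
      then show ?thesis
      proof cases
        case 1
        then show ?thesis using IH[OF H(1)] H(2) H'(2) by blast
      next
        case 2
        have "K \<subset> G"
          using clean_step_psubset H(1) 2(1) by blast
        then obtain P where P: "?nf K P"
          using ex1_implies_ex[OF psubset.IH[of K]] by metis
        then have "?nf H P" "?nf H' P"
          using 2 by (metis converse_rtranclp_into_rtranclp)+
        then have "N = P" "N' = P"
          using ex1E[OF IH[OF H(1)]] ex1E[OF IH[OF H'(1)]] H(2) H'(2) by metis+
        then show ?thesis
          by simp
      qed
    qed
    moreover have "?nf G N"
      using H by (metis converse_rtranclp_into_rtranclp)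
    ultimately show ?thesis by blast
  qed
qed

lemma ex1_final_graph:
  assumes "X \<subseteq> edges M"
  shows "\<exists>!G. final_graph M X G"
  unfolding final_graph_def using ex1_clean_normal_form[OF assms finite_D_graph[OF assms]] .

lemma final_graph_active_graph:
  assumes "X \<subseteq> edges M"
  shows "final_graph M X (active_graph M X)"
  unfolding active_graph_def by (rule theI'[OF ex1_final_graph[OF assms]])

end

end

theory Submission
  imports Defs
begin

text \<open>
  Let \<open>X\<close> and \<open>Y\<close> be stable with \<open>X \<prec>\<^sub>F Y\<close>. Everything takes place on the set of \<^emph>\<open>movers\<close>, the
  vertices of \<open>W\<close> whose edge in \<open>X\<close> is not in \<open>Y\<close>.

  Stability of \<open>X\<close> makes every edge of \<open>Y - X\<close> worse, for its end in \<open>W\<close>, than an edge of \<open>X\<close>. So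
  \<open>Y\<close> covers no more vertices of \<open>W\<close> than \<open>X\<close>, while (A3) gives \<open>|X\<^sub>f| \<le> |Y\<^sub>f|\<close> at every \<open>f\<close>;
  counting edges, both become equalities (\<open>card_at_F_eq\<close>, \<open>fst_image_eq\<close>). Hence a mover \<open>w\<close> also
  has an edge \<open>y\<close> in \<open>Y\<close>. It is a candidate for the \<open>W\<close>-admissible edge, so \<open>a\<^sub>w\<close> exists and is \<open>y\<close>
  or better than \<open>y\<close>. Unless it lies in \<open>Y\<close>, it must not block \<open>Y\<close> and so is rejected by
  the end \<open>f\<close> of \<open>a\<^sub>w\<close> in \<open>F\<close>; in both cases
  \<open>C\<^sub>f (Y\<^sub>f \<union> X\<^sub>f \<union> {a\<^sub>w}) = Y\<^sub>f\<close>. Because \<open>|X\<^sub>f| = |Y\<^sub>f|\<close>, adding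
  \<open>a\<^sub>w\<close> to \<open>X\<^sub>f\<close> must expel an edge \<open>b\<close>, and \<open>b\<close> is not in \<open>Y\<close> because \<open>C\<^sub>f\<close> keeps the edges
  of \<open>Y\<close>. So the other end of \<open>b\<close> is again a mover (\<open>mover_tandem\<close>).

  This defines a map of the finite nonempty set of movers to itself, and such a map has a cycle. The
  tandems along the cycle form a closed walk of \<open>D(X)\<close> in which every vertex of \<open>W\<close> has an
  entering edge, so the cleaning procedure never touches it (\<open>closed_tandems_survive\<close>): it is a rotation
  of \<open>X\<close>. Applying it keeps the size at every \<open>f\<close>, which forces \<open>C\<^sub>f (X\<^sub>f \<union> L\<^sup>+\<^sub>f) = X'\<^sub>f\<close>, and
  since \<open>Y\<close> rejects every edge of \<open>L\<^sup>+ - Y\<close>, the result is still below \<open>Y\<close> (\<open>exchange_preceq\<close>).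
\<close>

section \<open>Finite dynamics and linear orders\<close>

lemma self_map_has_cycle:
  fixes g :: "'a \<Rightarrow> 'a"
  assumes "finite S" "S \<noteq> {}" and g: "g ` S \<subseteq> S"
  obtains x k where "0 < k" "(g ^^ k) x = x" "inj_on (\<lambda>i. (g ^^ i) x) {..<k}"
    "(\<lambda>i. (g ^^ i) x) ` {..<k} \<subseteq> S"
proof -
  obtain s where s: "s \<in> S"
    using assms(2) by blast
  have stay: "(g ^^ i) u \<in> S" if "u \<in> S" for i u
    using that g by (induction i) auto
  have "\<not> inj (\<lambda>i. (g ^^ i) s)"
    using stay[OF s] finite_subset[OF _ assms(1), of "range (\<lambda>i. (g ^^ i) s)"]
      finite_imageD by fastforce
  then obtain i j where ij: "i < j" "(g ^^ i) s = (g ^^ j) s"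
    unfolding inj_def by (metis linorder_neqE_nat)
  define x where "x = (g ^^ i) s"
  have per: "(g ^^ (j - i)) x = x"
    using ij unfolding x_def by (metis add.commute comp_apply funpow_add le_add_diff_inverse less_imp_le)
  \<comment> \<open>The least period: the points of the cycle are then distinct.\<close>
  define k where "k = (LEAST k. 0 < k \<and> (g ^^ k) x = x)"
  have k: "0 < k" "(g ^^ k) x = x"
    using LeastI[of "\<lambda>k. 0 < k \<and> (g ^^ k) x = x" "j - i"] per ij(1) unfolding k_def by auto
  have no_return: "(g ^^ p) x \<noteq> (g ^^ q) x" if "p < q" "q < k" for p q
  proof
    assume eq: "(g ^^ p) x = (g ^^ q) x"
    have "(g ^^ (k - q + p)) x = (g ^^ (k - q)) ((g ^^ q) x)"
      by (simp add: funpow_add eq)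
    also have "\<dots> = (g ^^ k) x"
      using that by (metis comp_apply funpow_add le_add_diff_inverse2 less_imp_le)
    finally have "(g ^^ (k - q + p)) x = x"
      using k(2) by simp
    then show False
      using not_less_Least[of "k - q + p" "\<lambda>k. 0 < k \<and> (g ^^ k) x = x", folded k_def] that
      by linarith
  qed
  then have "inj_on (\<lambda>i. (g ^^ i) x) {..<k}"
    by (metis (mono_tags, lifting) inj_onI lessThan_iff linorder_neqE_nat)
  moreover have "(\<lambda>i. (g ^^ i) x) ` {..<k} \<subseteq> S"
    using stay stay[OF s] unfolding x_def by blast
  ultimately show thesis
    using that k by blast
qed

lemma best_nonempty:
  assumes "finite Z" "Z \<noteq> {}" "Z \<subseteq> A" "strict_linear_order_on A r"
  shows "best r Z \<noteq> {}"
  using assms(1-3)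
proof (induction Z rule: finite_ne_induct)
  case (singleton x)
  then show ?case by (simp add: best_def)
next
  case (insert x Z)
  have tr: "trans r" and tot: "total_on A r"
    using assms(4) by (auto simp: strict_linear_order_on_def)
  obtain e where e: "e \<in> Z" "\<forall>e' \<in> Z - {e}. (e, e') \<in> r"
    using insert unfolding best_def by auto
  have "x \<noteq> e"
    using e insert by blast
  then consider "(x, e) \<in> r" | "(e, x) \<in> r"
    using tot e insert.prems unfolding total_on_def by blast
  then show ?case
  proof cases
    case 1
    then have "x \<in> best r (insert x Z)"
      using e tr unfolding best_def trans_def by blast
    then show ?thesis by blast
  next
    case 2
    then have "e \<in> best r (insert x Z)"
      using e unfolding best_def by blast
    then show ?thesis by blast
  qed
qed

section \<open>Acceptability and stability edge by edge\<close>

context choice_market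
begin

lemma at_W: "X \<subseteq> edges M \<Longrightarrow> w \<in> Wpart M \<Longrightarrow> at_vertex X w = {e \<in> X. fst e = w}"
  using edges_subset disjoint_parts unfolding at_vertex_def by fastforce

lemma at_F: "X \<subseteq> edges M \<Longrightarrow> f \<in> Fpart M \<Longrightarrow> at_vertex X f = {e \<in> X. snd e = f}"
  using edges_subset disjoint_parts unfolding at_vertex_def by fastforce

lemma at_vertex_mono: "X \<subseteq> Y \<Longrightarrow> at_vertex X v \<subseteq> at_vertex Y v"
  unfolding at_vertex_def by blast

lemma edge_ends: "e \<in> edges M \<Longrightarrow> fst e \<in> Wpart M" "e \<in> edges M \<Longrightarrow> snd e \<in> Fpart M"
  using edges_subset by auto

lemma choice_at_F: "f \<in> Fpart M \<Longrightarrow> choice M f = chF M f"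
  using disjoint_parts by (auto simp: choice_def fun_eq_iff)

lemma finite_edges: "finite (edges M)"
  using finite_subset[OF edges_subset] finite_W finite_F by blast

text \<open>Quota one on the \<open>W\<close> side is injectivity of the first projection.\<close>

lemma acceptable_iff:
  "acceptable M X \<longleftrightarrow> X \<subseteq> edges M \<and> inj_on fst X \<and>
     (\<forall>f \<in> Fpart M. chF M f (at_vertex X f) = at_vertex X f)"
proof (cases "X \<subseteq> edges M")
  case True
  have "(\<forall>w \<in> Wpart M. choice M w (at_vertex X w) = at_vertex X w) \<longleftrightarrow> inj_on fst X"
  proof
    assume acc: "\<forall>w \<in> Wpart M. choice M w (at_vertex X w) = at_vertex X w"
    show "inj_on fst X"
    proof (rule inj_onI, rule ccontr)
      fix e e' assume e: "e \<in> X" "e' \<in> X" "fst e = fst e'" "e \<noteq> e'"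
      have w: "fst e \<in> Wpart M"
        using e True edge_ends by blast
      have "best (pref M (fst e)) (at_vertex X (fst e)) = at_vertex X (fst e)"
        using acc w by (simp add: choice_def)
      moreover have "e \<in> at_vertex X (fst e)" "e' \<in> at_vertex X (fst e)"
        using e by (auto simp: at_vertex_def)
      ultimately have "(e, e') \<in> pref M (fst e)" "(e', e) \<in> pref M (fst e)"
        using e(4) unfolding best_def by blast+
      then show False
        using pref_linear[OF w] unfolding strict_linear_order_on_def
        by (metis irreflD transD)
    qed
  next
    assume "inj_on fst X"
    then show "\<forall>w \<in> Wpart M. choice M w (at_vertex X w) = at_vertex X w"
      using at_W[OF True] by (auto simp: choice_def best_def inj_on_def)
  qed
  moreover have "(\<forall>f \<in> Fpart M. choice M f (at_vertex X f) = at_vertex X f) \<longleftrightarrow>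
      (\<forall>f \<in> Fpart M. chF M f (at_vertex X f) = at_vertex X f)"
    using choice_at_F by simp
  ultimately show ?thesis
    using True unfolding acceptable_def ball_Un by blast
qed (simp add: acceptable_def)

lemma chosen_from_subset:
  assumes "f \<in> Fpart M" "Z \<subseteq> at_vertex (edges M) f" "Z' \<subseteq> Z" "e \<in> chF M f Z" "e \<in> Z'"
  shows "e \<in> chF M f Z'"
  using A2[OF assms(1-3)] assms(4,5) by blast

lemma stable_not_blocked:
  assumes st: "stable M X" and e: "e \<in> edges M" "e \<notin> X"
    and ch: "e \<in> chF M (snd e) (at_vertex X (snd e) \<union> {e})"
  obtains x where "at_vertex X (fst e) = {x}" "(x, e) \<in> pref M (fst e)"
proof -
  let ?w = "fst e"
  have X: "X \<subseteq> edges M" "inj_on fst X"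
    using st by (auto simp: stable_def acceptable_iff)
  have w: "?w \<in> Wpart M" and f: "snd e \<in> Fpart M"
    using edge_ends e by auto
  have "(?w, snd e) \<notin> choice M ?w (at_vertex X ?w \<union> {(?w, snd e)})"
    using st e ch f unfolding stable_def by (metis DiffI choice_at_F prod.collapse)
  then have nb: "e \<notin> best (pref M ?w) (at_vertex X ?w \<union> {e})"
    using w by (simp add: choice_def)
  then obtain x where x: "x \<in> at_vertex X ?w" "x \<noteq> e" "(e, x) \<notin> pref M ?w"
    unfolding best_def by blast
  have "at_vertex X ?w = {x}"
    using x(1) X(2) unfolding at_W[OF X(1) w] inj_on_def by auto
  moreover have "x \<in> at_vertex (edges M) ?w" "e \<in> at_vertex (edges M) ?w"
    using x(1) e(1) X(1) by (auto simp: at_vertex_def)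
  then have "(x, e) \<in> pref M ?w"
    using pref_linear[OF w] x(2,3) unfolding strict_linear_order_on_def total_on_def by blast
  ultimately show thesis
    using that by blast
qed

section \<open>Closed systems of tandems give rotations\<close>

lemma tandemD:
  assumes "tandem M X a b" "X \<subseteq> edges M"
  shows "W_admissible M X (fst a) a" "a \<in> edges M" "a \<notin> X" "b \<in> X" "snd b = snd a"
    "chF M (snd a) (at_vertex X (snd a) \<union> {a}) = (at_vertex X (snd a) - {b}) \<union> {a}"
proof -
  obtain w where w: "W_admissible M X w a"
    using assms(1) by (auto simp: tandem_def)
  note D = W_admissibleD[OF w assms(2)]
  show "W_admissible M X (fst a) a" "a \<in> edges M" "a \<notin> X"
    using w D by auto
  show "b \<in> X" "snd b = snd a"
    using assms(1) at_F[OF assms(2) D(4)] by (auto simp: tandem_def)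
  show "chF M (snd a) (at_vertex X (snd a) \<union> {a}) = (at_vertex X (snd a) - {b}) \<union> {a}"
    using assms(1) choice_at_F[OF D(4)] by (simp add: tandem_def)
qed

lemma edge_not_reversed: "e \<in> edges M \<Longrightarrow> e' \<in> edges M \<Longrightarrow> e \<noteq> prod.swap e'"
  using edges_subset disjoint_parts by (cases e') auto

text \<open>
  Cleaning deletes \<open>a\<^sub>w\<close> only if nothing enters \<open>w\<close>, and an edge \<open>b\<close> only with the last tandem
  containing it. So a system of tandems in which every source is also a target is invariant.
\<close>

lemma closed_tandems_survive:
  assumes X: "X \<subseteq> edges M"
    and t: "\<And>w. w \<in> V \<Longrightarrow> tandem M X (a w) (b w) \<and> fst (a w) = w"
    and closed: "V \<subseteq> (\<lambda>w. fst (b w)) ` V"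
  shows "a ` V \<union> prod.swap ` b ` V \<subseteq> active_graph M X"
proof -
  let ?K = "a ` V \<union> prod.swap ` b ` V"
  note T = tandemD[OF conjunct1[OF t] X]
  have step: "?K \<subseteq> G'" if KG: "?K \<subseteq> G" and cl: "clean_step M X G G'" for G G'
  proof -
    obtain w' a' where c: "W_admissible M X w' a'" "\<nexists>u. (u, w') \<in> G"
      "G' = G - {a'} - {prod.swap b | b. tandem M X a' b \<and> \<not> (\<exists>a''. a'' \<noteq> a' \<and> tandem_in M X G a'' b)}"
      using cl unfolding clean_step_def by blast
    have e': "a' \<in> edges M" "fst a' = w'"
      using W_admissibleD[OF c(1) X] by auto
    have notK: "a' \<notin> ?K"
    proof
      assume "a' \<in> ?K"
      moreover have "a' \<noteq> prod.swap (b u)" if "u \<in> V" for u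
        using edge_not_reversed[OF e'(1), of "b u"] T(4)[OF that] X by blast
      ultimately have "a' \<in> a ` V"
        by blast
      then have "w' \<in> V"
        using t e'(2) by auto
      then obtain u where "u \<in> V" "w' = fst (b u)"
        using closed by blast
      then have "(snd (b u), w') \<in> ?K"
        by (force simp: prod.swap_def)
      then show False
        using KG c(2) by blast
    qed
    show ?thesis
    proof
      fix d assume d: "d \<in> ?K"
      show "d \<in> G'"
      proof (rule ccontr)
        assume "d \<notin> G'"
        then obtain b' where b': "d = prod.swap b'" "tandem M X a' b'"
          "\<nexists>a''. a'' \<noteq> a' \<and> tandem_in M X G a'' b'"
          using d notK KG unfolding c(3) by blast
        have "b' \<in> edges M"
          using tandemD(4)[OF b'(2) X] X by blast
        then have "d \<noteq> a u" if "u \<in> V" for u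
          using edge_not_reversed[OF T(2)[OF that]] b'(1) by blast
        then have "d \<in> prod.swap ` b ` V"
          using d by blast
        then obtain u where u: "u \<in> V" "d = prod.swap (b u)"
          by blast
        then have "b' = b u"
          using b'(1) by (metis swap_swap)
        then have "tandem_in M X G (a u) b'"
          using u(1) t KG unfolding tandem_in_def by blast
        moreover have "a u \<noteq> a'"
          using notK u(1) by blast
        ultimately show False
          using b'(3) by blast
      qed
    qed
  qed
  have "a w \<in> D_graph M X" "prod.swap (b w) \<in> D_graph M X" if "w \<in> V" for w
    using t[OF that] T(1)[OF that] unfolding D_graph_def by blast+
  then have start: "?K \<subseteq> D_graph M X"
    by blast
  have "(clean_step M X)\<^sup>*\<^sup>* (D_graph M X) (active_graph M X)"
    using final_graph_active_graph[OF X] by (simp add: final_graph_def)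
  then show ?thesis
    by (rule rtranclp_induct) (rule start, erule step)
qed

text \<open>
  The cycle alternates between the two kinds of arcs: the walk enters \<open>v (Suc i)\<close> by the reversed edge
  \<open>b (v i)\<close> and leaves it by \<open>a (v (Suc i))\<close>. Arcs of one kind are told apart by their ends in \<open>W\<close>.
\<close>

lemma tandem_cycle_rotation:
  assumes X: "X \<subseteq> edges M"
    and k: "0 < k" "v k = v 0" and inj: "inj_on v {..<k}"
    and t: "\<And>i. i < k \<Longrightarrow> tandem M X (a (v i)) (b (v i)) \<and> fst (a (v i)) = v i"
    and nxt: "\<And>i. i < k \<Longrightarrow> fst (b (v i)) = v (Suc i)"
  shows "a ` v ` {..<k} \<union> prod.swap ` b ` v ` {..<k} \<in> rotations M X"
proof -
  let ?V = "v ` {..<k}"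
  note T = tandemD[OF conjunct1[OF t] X]
  define arc where "arc j = (if even j then a (v (j div 2)) else prod.swap (b (v (j div 2))))" for j
  let ?ds = "map arc [0..<2 * k]"
  have Suc_mod: "v (Suc i) = v (Suc i mod k)" if "i < k" for i
    using that k by (metis Suc_lessI mod_less mod_self)
  have inj_next: "i = j" if "i < k" "j < k" "v (Suc i) = v (Suc j)" for i j
  proof -
    have "Suc i mod k = Suc j mod k"
      using that inj k(1) Suc_mod unfolding inj_on_def by (metis lessThan_iff mod_less_divisor)
    then show ?thesis
      using that by (auto simp: mod_Suc split: if_splits)
  qed
  have range_V: "?V \<subseteq> (\<lambda>w. fst (b w)) ` ?V"
  proof
    fix w assume "w \<in> ?V"
    then obtain i where i: "i < k" "w = v i" by blast
    show "w \<in> (\<lambda>w. fst (b w)) ` ?V"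
    proof (cases i)
      case 0
      then have "w = fst (b (v (k - 1)))"
        using i k nxt[of "k - 1"] by simp
      then show ?thesis using k(1) by auto
    next
      case (Suc j)
      then have "w = fst (b (v j))" "v j \<in> ?V"
        using i nxt[of j] by auto
      then show ?thesis by blast
    qed
  qed
  have set_arc: "set ?ds = a ` ?V \<union> prod.swap ` b ` ?V"
  proof
    show "set ?ds \<subseteq> a ` ?V \<union> prod.swap ` b ` ?V"
      by (auto simp: arc_def)
    have "a (v i) = arc (2 * i)" "prod.swap (b (v i)) = arc (2 * i + 1)" for i
      by (simp_all add: arc_def)
    then show "a ` ?V \<union> prod.swap ` b ` ?V \<subseteq> set ?ds"
      by fastforce
  qed
  have "inj_on arc {..<2 * k}"
  proof (rule inj_onI)
    fix p q assume pq: "p \<in> {..<2 * k}" "q \<in> {..<2 * k}" "arc p = arc q"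
    have lt: "p div 2 < k" "q div 2 < k"
      using pq by auto
    have not_mixed: "a (v i) \<noteq> prod.swap (b (v j))" if "i < k" "j < k" for i j
      using edge_not_reversed[OF T(2)[OF that(1)]] T(4)[OF that(2)] X by blast
    have "even p = even q"
      using pq(3) lt not_mixed unfolding arc_def by (metis (full_types))
    moreover have "p div 2 = q div 2"
    proof (cases "even p")
      case True
      then have "v (p div 2) = v (q div 2)"
        using pq(3) calculation t lt unfolding arc_def by metis
      then show ?thesis
        using inj lt unfolding inj_on_def by blast
    next
      case False
      then have "v (Suc (p div 2)) = v (Suc (q div 2))"
        using pq(3) calculation nxt lt unfolding arc_def by (metis swap_swap)
      then show ?thesis
        using inj_next lt by blast
    qed
    ultimately show "p = q"
      by (metis dvd_mult_div_cancel odd_two_times_div_two_succ)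
  qed
  then have "distinct ?ds"
    by (simp add: distinct_map atLeast0LessThan)
  moreover have "set ?ds \<subseteq> active_graph M X"
    unfolding set_arc using closed_tandems_survive[OF X _ range_V] t by blast
  moreover have "follows M X (?ds ! j) (?ds ! (Suc j mod length ?ds))" if "j < length ?ds" for j
  proof -
    have j: "j < 2 * k" "j div 2 < k" "Suc j mod (2 * k) < 2 * k"
      using that k(1) by auto
    have nth: "?ds ! j = arc j" "?ds ! (Suc j mod length ?ds) = arc (Suc j mod (2 * k))"
      using j by simp_all
    show ?thesis
    proof (cases "even j")
      case True
      then have "Suc j < 2 * k"
        using j(1) by (metis Suc_lessI even_Suc even_mult_iff even_numeral)
      then have "arc (Suc j mod (2 * k)) = prod.swap (b (v (j div 2)))" "arc j = a (v (j div 2))"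
        using True by (simp_all add: arc_def)
      then show ?thesis
        unfolding nth follows_def using t[OF j(2)] by metis
    next
      case False
      have "arc (Suc j mod (2 * k)) = a (v (Suc (j div 2)))"
      proof (cases "Suc j = 2 * k")
        case True
        then have "Suc (j div 2) = k"
          using False by presburger
        then show ?thesis
          using True k by (simp add: arc_def)
      next
        case neq: False
        then show ?thesis
          using j False by (simp add: arc_def)
      qed
      moreover have "fst (a (v (Suc (j div 2)))) = v (Suc (j div 2))"
        using t[of "Suc (j div 2) mod k"] Suc_mod[OF j(2)] k(1) by simp
      moreover have "snd (arc j) = v (Suc (j div 2))"
        using False nxt[OF j(2)] by (simp add: arc_def)
      moreover have "v (Suc (j div 2)) \<in> Wpart M"
        using nxt[OF j(2)] T(4)[OF j(2)] X edge_ends(1) by (metis subsetD)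
      ultimately show ?thesis
        unfolding nth follows_def by metis
    qed
  qed
  moreover have "?ds \<noteq> []"
    using k(1) by simp
  ultimately have "rotation_cycle M X ?ds"
    unfolding rotation_cycle_def by blast
  then show ?thesis
    unfolding rotations_def set_arc[symmetric] by blast
qed

end

section \<open>Two comparable stable matchings\<close>

locale comparable_stable = choice_market M for M :: "'v market" +
  fixes X Y :: "('v \<times> 'v) set"
  assumes stable_X: "stable M X" and stable_Y: "stable M Y" and prec: "prec_F M X Y"
begin

lemma X_acc: "X \<subseteq> edges M" "inj_on fst X"
    "f \<in> Fpart M \<Longrightarrow> chF M f (at_vertex X f) = at_vertex X f"
  using stable_X by (auto simp: stable_def acceptable_iff)

lemma Y_acc: "Y \<subseteq> edges M" "inj_on fst Y"
    "f \<in> Fpart M \<Longrightarrow> chF M f (at_vertex Y f) = at_vertex Y f"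
  using stable_Y by (auto simp: stable_def acceptable_iff)

lemma choice_union: "f \<in> Fpart M \<Longrightarrow> chF M f (at_vertex Y f \<union> at_vertex X f) = at_vertex Y f"
  using prec choice_at_F by (simp add: prec_F_def succeq_at_def)

lemma Y_edge_wanted:
  assumes "y \<in> Y"
  shows "y \<in> chF M (snd y) (at_vertex X (snd y) \<union> {y})"
proof -
  have f: "snd y \<in> Fpart M"
    using edge_ends Y_acc(1) assms by blast
  have y: "y \<in> at_vertex Y (snd y)"
    using assms by (simp add: at_vertex_def)
  show ?thesis
    using chosen_from_subset[OF f, of "at_vertex Y (snd y) \<union> at_vertex X (snd y)"
        "at_vertex X (snd y) \<union> {y}" y] choice_union[OF f] y
      at_vertex_mono[OF X_acc(1)] at_vertex_mono[OF Y_acc(1)] by blast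
qed

lemma W_prefers_X:
  assumes "y \<in> Y - X"
  obtains x where "at_vertex X (fst y) = {x}" "(x, y) \<in> pref M (fst y)"
  using stable_not_blocked[OF stable_X _ _ Y_edge_wanted] assms Y_acc(1) by blast

text \<open>
  Each part of the graph gives an inequality between \<open>card X\<close> and \<open>card Y\<close>, in opposite directions, so
  the termwise inequalities behind them are all equalities.
\<close>

lemma
  shows card_at_F_eq: "f \<in> Fpart M \<Longrightarrow> card (at_vertex X f) = card (at_vertex Y f)"
    and fst_image_eq: "fst ` X = fst ` Y"
proof -
  have fin: "finite X" "finite Y"
    using finite_edges X_acc(1) Y_acc(1) finite_subset by blast+
  \<comment> \<open>On the side of \<open>F\<close>, the inequality holds vertex by vertex.\<close>
  have le: "card (at_vertex X f) \<le> card (at_vertex Y f)" if "f \<in> Fpart M" for f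
    using A3[OF that, of "at_vertex Y f \<union> at_vertex X f" "at_vertex X f"] X_acc(3)[OF that]
      choice_union[OF that] at_vertex_mono[OF X_acc(1)] at_vertex_mono[OF Y_acc(1)] by simp
  have total: "card Z = (\<Sum>f\<in>Fpart M. card (at_vertex Z f))" if "Z \<subseteq> edges M" for Z
  proof -
    have "Z = (\<Union>f\<in>Fpart M. at_vertex Z f)"
      using that edge_ends(2) by (auto simp: at_vertex_def)
    moreover have "card (\<Union>f\<in>Fpart M. at_vertex Z f) = (\<Sum>f\<in>Fpart M. card (at_vertex Z f))"
    proof (rule card_UN_disjoint[OF finite_F])
      show "\<forall>f\<in>Fpart M. finite (at_vertex Z f)"
        using that finite_edges by (auto simp: at_vertex_def intro: finite_subset)
      show "\<forall>f\<in>Fpart M. \<forall>f'\<in>Fpart M. f \<noteq> f' \<longrightarrow> at_vertex Z f \<inter> at_vertex Z f' = {}"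
        using at_F[OF that] by auto
    qed
    ultimately show ?thesis by simp
  qed
  \<comment> \<open>On the side of \<open>W\<close>, where edges count covered vertices, it is reversed.\<close>
  have sub: "fst ` Y \<subseteq> fst ` X"
  proof
    fix w assume "w \<in> fst ` Y"
    then obtain y where y: "y \<in> Y" "w = fst y" by blast
    show "w \<in> fst ` X"
    proof (cases "y \<in> X")
      case False
      then obtain x where "at_vertex X w = {x}"
        using W_prefers_X y by blast
      then have "x \<in> at_vertex X w" by blast
      moreover have "w \<in> Wpart M"
        using y Y_acc(1) edge_ends by blast
      ultimately show ?thesis
        using at_W[OF X_acc(1)] by auto
    qed (use y in blast)
  qed
  have card_fst: "card (fst ` X) = card X" "card (fst ` Y) = card Y"
    using X_acc(2) Y_acc(2) by (auto simp: card_image)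
  have XY: "card X \<le> card Y"
    unfolding total[OF X_acc(1)] total[OF Y_acc(1)] using le by (rule sum_mono)
  moreover have "card Y \<le> card X"
    using card_mono[OF _ sub] fin card_fst by simp
  ultimately have eq: "card X = card Y" by simp
  show "fst ` X = fst ` Y"
    using card_subset_eq[OF _ sub] fin card_fst eq by simp
  show "card (at_vertex X f) = card (at_vertex Y f)" if "f \<in> Fpart M"
    using sum_mono_inv[OF eq[unfolded total[OF X_acc(1)] total[OF Y_acc(1)]] le that finite_F] .
qed

text \<open>
  If \<open>C\<^sub>f\<close> chose an edge outside \<open>Y\<close> from a large set, then by (A2) it would also choose it when the
  edge is offered alone in addition to \<open>Y\<^sub>f\<close>. So edges rejected one by one are rejected together.
\<close>

lemma choice_keeps_Y:
  assumes f: "f \<in> Fpart M" and A: "A \<subseteq> at_vertex (edges M) f"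
    and rej: "\<And>e. e \<in> A - Y \<Longrightarrow> e \<notin> chF M f (at_vertex Y f \<union> {e})"
    and Z: "at_vertex Y f \<subseteq> Z" "Z \<subseteq> at_vertex Y f \<union> at_vertex X f \<union> A"
  shows "chF M f Z = at_vertex Y f"
proof -
  have E: "at_vertex Y f \<union> at_vertex X f \<union> A \<subseteq> at_vertex (edges M) f"
    using A at_vertex_mono[OF X_acc(1)] at_vertex_mono[OF Y_acc(1)] by blast
  then have ZE: "Z \<subseteq> at_vertex (edges M) f"
    using Z by blast
  have "chF M f Z \<subseteq> at_vertex Y f"
  proof
    fix e assume e: "e \<in> chF M f Z"
    then have eZ: "e \<in> Z"
      using ch_subset[OF f ZE] by blast
    show "e \<in> at_vertex Y f"
    proof (rule ccontr)
      assume n: "e \<notin> at_vertex Y f"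
      have "e \<in> chF M f (at_vertex Y f \<union> {e})"
        using chosen_from_subset[OF f ZE _ e, of "at_vertex Y f \<union> {e}"] Z eZ by blast
      moreover have "e \<in> A - Y" if "e \<notin> at_vertex X f"
        using that n eZ Z A unfolding at_vertex_def by blast
      moreover have "e \<notin> chF M f (at_vertex Y f \<union> {e})" if "e \<in> at_vertex X f"
      proof -
        have "chF M f (at_vertex Y f \<union> {e}) = chF M f (at_vertex Y f \<union> at_vertex X f)"
          using A1[OF f, of "at_vertex Y f \<union> at_vertex X f" "at_vertex Y f \<union> {e}"]
            choice_union[OF f] E that by blast
        then show ?thesis
          using choice_union[OF f] n by simp
      qed
      ultimately show False
        using rej by blast
    qed
  qed
  then have "chF M f (at_vertex Y f) = chF M f Z"
    using A1[OF f ZE Z(1)] by blast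
  then show ?thesis
    using Y_acc(3)[OF f] by simp
qed

section \<open>Movers and their tandems\<close>

definition movers :: "'v set" where
  "movers = fst ` (X - Y)"

lemma mover_edges:
  assumes "w \<in> movers"
  obtains x y where "at_vertex X w = {x}" "y \<in> Y - X" "fst y = w" "(x, y) \<in> pref M w"
proof -
  obtain x where x: "x \<in> X" "x \<notin> Y" "fst x = w"
    using assms by (auto simp: movers_def)
  then have "w \<in> fst ` Y"
    using fst_image_eq by blast
  then obtain y where y: "y \<in> Y" "fst y = w" by blast
  have "y \<notin> X"
    using X_acc(2) x y unfolding inj_on_def by metis
  then show thesis
    using W_prefers_X[of y] y that by blast
qed

lemma movers_nonempty: "movers \<noteq> {}"
proof
  assume "movers = {}"
  then have "X \<subseteq> Y"
    by (auto simp: movers_def)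
  moreover have "Y \<subseteq> X"
  proof
    fix y assume y: "y \<in> Y"
    then obtain x where "x \<in> X" "fst x = fst y"
      using fst_image_eq by (metis imageE imageI)
    then show "y \<in> X"
      using Y_acc(2) y \<open>X \<subseteq> Y\<close> unfolding inj_on_def by (metis subsetD)
  qed
  ultimately show False
    using prec by (simp add: prec_F_def)
qed

text \<open>
  The edge of \<open>Y\<close> at a mover is itself a candidate, so the admissible edge is at least as good; if it is
  not in \<open>Y\<close> and \<open>Y\<close> could use it, then it would block \<open>Y\<close>.
\<close>

lemma mover_admissible:
  assumes w: "w \<in> movers"
  obtains a where "W_admissible M X w a" "a \<notin> Y \<Longrightarrow> a \<notin> chF M (snd a) (at_vertex Y (snd a) \<union> {a})"
proof -
  obtain x y where xy: "at_vertex X w = {x}" "y \<in> Y - X" "fst y = w" "(x, y) \<in> pref M w"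
    using mover_edges[OF w] by blast
  have yE: "y \<in> edges M"
    using xy(2) Y_acc(1) by blast
  have W: "w \<in> Wpart M" "snd y \<in> Fpart M"
    using edge_ends[OF yE] xy(3) by auto
  let ?C = "W_candidates M X w"
  have yC: "y \<in> ?C"
    using xy yE Y_edge_wanted[of y] choice_at_F[OF W(2)]
    by (auto simp: W_candidates_def at_vertex_def)
  have CE: "?C \<subseteq> at_vertex (edges M) w"
    by (auto simp: W_candidates_def)
  have "finite ?C"
    using CE finite_edges by (auto simp: at_vertex_def intro: finite_subset)
  then obtain a where a: "a \<in> best (pref M w) ?C"
    using best_nonempty[OF _ _ CE pref_linear[OF W(1)]] yC by blast
  have adm: "W_admissible M X w a"
    using a W by (simp add: W_admissible_def)
  note D = W_admissibleD[OF adm X_acc(1)]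
  have "a \<notin> chF M (snd a) (at_vertex Y (snd a) \<union> {a})" if n: "a \<notin> Y"
  proof
    assume "a \<in> chF M (snd a) (at_vertex Y (snd a) \<union> {a})"
    then obtain y' where y': "at_vertex Y w = {y'}" "(y', a) \<in> pref M w"
      using stable_not_blocked[OF stable_Y D(1) n] D(2) by metis
    have "y \<in> at_vertex Y w"
      using xy by (auto simp: at_vertex_def)
    then have "y' = y"
      using y'(1) by simp
    moreover have "(a, y) \<in> pref M w"
      using a yC n xy(2) unfolding best_def by blast
    ultimately show False
      using y'(2) pref_linear[OF W(1)] unfolding strict_linear_order_on_def
      by (metis irreflD transD)
  qed
  then show thesis
    using that adm by blast
qed

text \<open>
  Since \<open>C\<^sub>f (Y\<^sub>f \<union> X\<^sub>f \<union> {a}) = Y\<^sub>f\<close> has no more elements than \<open>X\<^sub>f\<close>, the edge \<open>a\<close> has to displace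
  exactly one edge of \<open>X\<^sub>f\<close>, and by (A2) not one of \<open>Y\<close>.
\<close>

lemma mover_tandem:
  assumes w: "w \<in> movers"
  obtains a b where "tandem M X a b" "fst a = w" "b \<in> X - Y"
    "a \<notin> Y \<Longrightarrow> a \<notin> chF M (snd a) (at_vertex Y (snd a) \<union> {a})"
proof -
  obtain a where adm: "W_admissible M X w a"
    and rej: "a \<notin> Y \<Longrightarrow> a \<notin> chF M (snd a) (at_vertex Y (snd a) \<union> {a})"
    using mover_admissible[OF w] by blast
  note D = W_admissibleD[OF adm X_acc(1)]
  define f where "f = snd a"
  have f: "f \<in> Fpart M"
    using D(4) f_def by simp
  let ?Xf = "at_vertex X f" and ?Yf = "at_vertex Y f"
  let ?C = "chF M f (?Xf \<union> {a})"
  have aE: "{a} \<subseteq> at_vertex (edges M) f"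
    using D(1) by (auto simp: at_vertex_def f_def)
  have XE: "?Xf \<subseteq> at_vertex (edges M) f" "?Yf \<subseteq> at_vertex (edges M) f"
    using at_vertex_mono[OF X_acc(1)] at_vertex_mono[OF Y_acc(1)] by auto
  have fin: "finite ?Xf"
    using finite_subset[OF X_acc(1) finite_edges] by (simp add: at_vertex_def)
  have all: "chF M f (?Yf \<union> ?Xf \<union> {a}) = ?Yf"
    using choice_keeps_Y[OF f aE, of "?Yf \<union> ?Xf \<union> {a}"] rej unfolding f_def by blast
  have "card ?C \<le> card ?Xf"
    using A3[OF f, of "?Yf \<union> ?Xf \<union> {a}" "?Xf \<union> {a}"] all card_at_F_eq[OF f] aE XE by auto
  moreover have "card ?Xf \<le> card ?C"
    using A3[OF f, of "?Xf \<union> {a}" ?Xf] X_acc(3)[OF f] aE XE by auto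
  ultimately have card_C: "card ?C = card ?Xf" by simp
  have sub: "?C \<subseteq> ?Xf \<union> {a}"
    using ch_subset[OF f] aE XE by simp
  have aC: "a \<in> ?C"
    using adm choice_at_F[OF f] unfolding W_admissible_def best_def W_candidates_def f_def by auto
  have an: "a \<notin> ?Xf"
    using D(5) by (simp add: at_vertex_def)
  \<comment> \<open>\<open>?C\<close> loses exactly one of the \<open>card ?Xf + 1\<close> offered edges.\<close>
  have "card (?Xf \<union> {a} - ?C) = 1"
    using card_Diff_subset[OF finite_subset[OF sub] sub] fin an card_C by simp
  then obtain b where b: "?Xf \<union> {a} - ?C = {b}"
    using card_1_singletonE by blast
  then have bX: "b \<in> ?Xf" "b \<notin> ?C"
    using aC by auto
  have "?C = ?Xf - {b} \<union> {a}"
    using b sub aC an by blast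
  then have "tandem M X a b"
    using adm bX choice_at_F[OF f] unfolding tandem_def f_def by auto
  moreover have "b \<notin> Y"
  proof
    assume "b \<in> Y"
    then have "b \<in> chF M f (?Yf \<union> ?Xf \<union> {a})"
      using bX(1) unfolding all by (simp add: at_vertex_def)
    then have "b \<in> ?C"
      using chosen_from_subset[OF f, of "?Yf \<union> ?Xf \<union> {a}" "?Xf \<union> {a}" b] bX aE XE by blast
    then show False
      using bX by blast
  qed
  ultimately show thesis
    using that rej D(2) bX(1) by (auto simp: at_vertex_def)
qed

section \<open>Applying a cycle of tandems\<close>

text \<open>
  At each \<open>f\<close> the displaced edges stay rejected when all new edges are offered at once, and (A3) leaves no
  room for rejecting anything else.
\<close>

lemma exchange_preceq:
  assumes t: "\<And>w. w \<in> V \<Longrightarrow> tandem M X (a w) (b w) \<and> fst (a w) = w"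
    and rej: "\<And>w. w \<in> V \<Longrightarrow> a w \<notin> Y \<Longrightarrow>
      a w \<notin> chF M (snd (a w)) (at_vertex Y (snd (a w)) \<union> {a w})"
    and V: "V \<subseteq> (\<lambda>w. fst (b w)) ` V" and b_inj: "inj_on b V"
  shows "preceq_F M (X - b ` V \<union> a ` V) Y"
proof -
  let ?X' = "X - b ` V \<union> a ` V"
  note T = tandemD[OF conjunct1[OF t] X_acc(1)]
  have sub: "?X' \<subseteq> edges M"
    using X_acc(1) T(2) by blast
  have "e = e'" if e: "e \<in> ?X'" "e' \<in> ?X'" "fst e = fst e'" for e e'
  proof -
    \<comment> \<open>A vertex that receives a new edge has lost its old one, as \<open>V\<close> consists of ends of edges \<open>b u\<close>.\<close>
    have mixed: False if m: "p \<in> X - b ` V" "w \<in> V" "fst p = w" for p w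
    proof -
      obtain u where u: "u \<in> V" "w = fst (b u)"
        using V m(2) by blast
      then have "p = b u"
        using m T(4)[OF u(1)] X_acc(2) unfolding inj_on_def by (metis DiffD1)
      then show False
        using m u by blast
    qed
    show ?thesis
    proof (cases "e \<in> X - b ` V \<longleftrightarrow> e' \<in> X - b ` V")
      case True
      then consider "e \<in> X" "e' \<in> X" | "e \<in> a ` V" "e' \<in> a ` V"
        using e by blast
      then show ?thesis
        by cases (use X_acc(2) e(3) t in \<open>auto simp: inj_on_def\<close>)
    next
      case False
      then show ?thesis
        using e mixed t by (metis UnE imageE)
    qed
  qed
  then have inj: "inj_on fst ?X'"
    by (intro inj_onI)
  have at_f: "chF M f (at_vertex ?X' f) = at_vertex ?X' f \<and>
      chF M f (at_vertex Y f \<union> at_vertex ?X' f) = at_vertex Y f" if f: "f \<in> Fpart M" for f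
  proof -
    define Vf where "Vf = {w \<in> V. snd (a w) = f}"
    have Vf: "Vf \<subseteq> V"
      by (auto simp: Vf_def)
    let ?Xf = "at_vertex X f"
    have "Vf = {w \<in> V. snd (b w) = f}"
      unfolding Vf_def using T(5) by (simp cong: conj_cong)
    then have bV: "b ` Vf = {e \<in> b ` V. snd e = f}"
      by auto
    have aV: "a ` Vf = {e \<in> a ` V. snd e = f}"
      by (auto simp: Vf_def)
    have X'f: "at_vertex ?X' f = ?Xf - b ` Vf \<union> a ` Vf"
      unfolding at_F[OF sub f] at_F[OF X_acc(1) f] aV bV by blast
    have bsub: "b ` Vf \<subseteq> ?Xf"
      unfolding at_F[OF X_acc(1) f] bV using T(4) by blast
    have disj: "a ` Vf \<inter> ?Xf = {}"
      using T(3) Vf by (auto simp: at_vertex_def)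
    have fin: "finite ?Xf"
      using finite_subset[OF X_acc(1) finite_edges] by (simp add: at_vertex_def)
    have finV: "finite Vf"
      using finite_imageD[OF finite_subset[OF bsub fin] inj_on_subset[OF b_inj Vf]] .
    have "card (a ` Vf) = card Vf" "card (b ` Vf) = card Vf"
      using card_image[OF inj_on_subset[OF b_inj Vf]] card_image[of a Vf] t Vf
      by (auto simp: inj_on_def) (metis subsetD)
    then have card_X': "card (at_vertex ?X' f) = card ?Xf"
      unfolding X'f using disj fin finV bsub card_mono[OF fin bsub]
      by (subst card_Un_disjoint) (auto simp: card_Diff_subset)
    have aE: "a ` Vf \<subseteq> at_vertex (edges M) f"
      using T(2) unfolding at_F[OF order_refl f] Vf_def by auto
    have XE: "?Xf \<union> a ` Vf \<subseteq> at_vertex (edges M) f"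
      using aE at_vertex_mono[OF X_acc(1)] by blast
    let ?C = "chF M f (?Xf \<union> a ` Vf)"
    have "b w \<notin> ?C" if "w \<in> Vf" for w
    proof
      assume "b w \<in> ?C"
      then have "b w \<in> chF M f (?Xf \<union> {a w})"
        using chosen_from_subset[OF f XE, of "?Xf \<union> {a w}" "b w"] that bsub by blast
      moreover have wV: "w \<in> V" and fw: "f = snd (a w)"
        using that by (auto simp: Vf_def)
      ultimately show False
        using T(3)[OF wV] T(4)[OF wV] T(6)[OF wV] by auto
    qed
    then have Csub: "?C \<subseteq> at_vertex ?X' f"
      using ch_subset[OF f XE] unfolding X'f by blast
    have "card ?Xf \<le> card ?C"
      using A3[OF f XE, of ?Xf] X_acc(3)[OF f] by simp
    then have C: "?C = at_vertex ?X' f"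
      using card_seteq[OF _ Csub] card_X' fin finV unfolding X'f by simp
    have "chF M f (at_vertex ?X' f) = at_vertex ?X' f"
      using A1[OF f XE, of "at_vertex ?X' f"] C X'f by auto
    moreover have "chF M f (at_vertex Y f \<union> at_vertex ?X' f) = at_vertex Y f"
      by (rule choice_keeps_Y[OF f aE]) (use rej X'f in \<open>auto simp: Vf_def\<close>)
    ultimately show ?thesis by blast
  qed
  have "acceptable M ?X'"
    unfolding acceptable_iff using sub inj at_f by blast
  moreover have "acceptable M Y"
    using stable_Y by (simp add: stable_def)
  ultimately show ?thesis
    using at_f choice_at_F unfolding preceq_F_def prec_F_def succeq_at_def by auto
qed

lemma rotation_below: "\<exists>X' \<in> S_after M X. preceq_F M X' Y"
proof -
  have "\<forall>w \<in> movers. \<exists>a b. tandem M X a b \<and> fst a = w \<and> b \<in> X - Y \<and>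
      (a \<notin> Y \<longrightarrow> a \<notin> chF M (snd a) (at_vertex Y (snd a) \<union> {a}))"
    using mover_tandem by metis
  then obtain a b where ab: "\<And>w. w \<in> movers \<Longrightarrow> tandem M X (a w) (b w) \<and> fst (a w) = w \<and>
      b w \<in> X - Y \<and> (a w \<notin> Y \<longrightarrow> a w \<notin> chF M (snd (a w)) (at_vertex Y (snd (a w)) \<union> {a w}))"
    by metis
  define g where "g w = fst (b w)" for w
  have fin: "finite movers"
    using finite_subset[OF X_acc(1) finite_edges] by (simp add: movers_def)
  have g: "g ` movers \<subseteq> movers"
    using ab unfolding g_def movers_def by blast
  obtain s k where k: "0 < k" "(g ^^ k) s = s" "inj_on (\<lambda>i. (g ^^ i) s) {..<k}"
    "(\<lambda>i. (g ^^ i) s) ` {..<k} \<subseteq> movers"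
    by (rule self_map_has_cycle[OF fin movers_nonempty g])
  define v where "v i = (g ^^ i) s" for i
  define V where "V = v ` {..<k}"
  have VM: "V \<subseteq> movers"
    using k(4) by (simp add: V_def v_def)
  have nxt: "fst (b (v i)) = v (Suc i)" for i
    by (simp add: v_def g_def)
  have "a ` V \<union> prod.swap ` b ` V \<in> rotations M X" (is "?L \<in> _")
    unfolding V_def
  proof (rule tandem_cycle_rotation[OF X_acc(1) k(1)])
    show "v k = v 0" "inj_on v {..<k}"
      using k(2,3) by (simp_all add: v_def[abs_def])
    show "tandem M X (a (v i)) (b (v i)) \<and> fst (a (v i)) = v i" if "i < k" for i
      using ab VM that unfolding V_def by blast
  qed (rule nxt)
  then have "X - L_minus M ?L \<union> L_plus M ?L \<in> S_after M X"
    unfolding S_after_def by blast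
  moreover have "L_plus M ?L = a ` V" "L_minus M ?L = b ` V"
  proof -
    have aE: "a w \<in> edges M" and bE: "b w \<in> edges M" if "w \<in> V" for w
      using ab[of w] VM that tandemD(2)[of X "a w" "b w"] X_acc(1) by auto
    have "e \<noteq> prod.swap (b w)" "prod.swap e \<noteq> a w" if "e \<in> edges M" "w \<in> V" for e w
      using edge_not_reversed[OF that(1) bE[OF that(2)]]
        edge_not_reversed[OF aE[OF that(2)] that(1)] by (simp_all add: eq_commute)
    then have "e \<notin> prod.swap ` b ` V" "prod.swap e \<notin> a ` V" if "e \<in> edges M" for e
      using that by blast+
    moreover have "prod.swap e \<in> prod.swap ` b ` V \<longleftrightarrow> e \<in> b ` V" for e
      by (simp add: inj_image_mem_iff)
    moreover have "a ` V \<subseteq> edges M" "b ` V \<subseteq> edges M"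
      using aE bE by auto
    ultimately show "L_plus M ?L = a ` V" "L_minus M ?L = b ` V"
      unfolding L_plus_def L_minus_def by blast+
  qed
  moreover have gV: "(\<lambda>w. fst (b w)) ` V = V"
  proof -
    have "(\<lambda>w. fst (b w)) ` V = v ` Suc ` {..<k}"
      unfolding V_def image_image using nxt by simp
    also have "\<dots> = v ` {1..k}"
      by (simp add: image_Suc_lessThan)
    also have "\<dots> = V"
    proof -
      have "{1..k} = insert k {1..<k}" "{..<k} = insert 0 {1..<k}"
        using k(1) by auto
      moreover have "v k = v 0"
        using k(2) by (simp add: v_def)
      ultimately show ?thesis
        unfolding V_def by simp
    qed
    finally show ?thesis .
  qed
  \<comment> \<open>A self-map of a finite set that is onto is injective, so no edge is displaced twice.\<close>
  have "inj_on (\<lambda>w. fst (b w)) V"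
    using eq_card_imp_inj_on[of V "\<lambda>w. fst (b w)"] gV by (simp add: V_def)
  then have "inj_on b V"
    by (auto simp: inj_on_def)
  then have "preceq_F M (X - b ` V \<union> a ` V) Y"
    using exchange_preceq[of V a b] ab VM gV by blast
  ultimately show ?thesis
    by metis
qed

end

theorem proposition3p2:
  fixes M :: "'v market" and X Y :: "('v \<times> 'v) set"
  assumes "choice_market M"
    and "stable M X" and "X \<noteq> X_max M"
    and "stable M Y" and "prec_F M X Y"
  shows "\<exists>X' \<in> S_after M X. preceq_F M X' Y"
proof -
  interpret choice_market M
    by (rule assms(1))
  interpret comparable_stable M X Y
    by unfold_locales (use assms in auto)
  show ?thesis
    by (rule rotation_below)
qed

end
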